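(* Let $\mathbb{F}_q$ be a finite field, let $k,m,n,r$ be positive integers with $r<\min\{m,n\}$, let $M_1,\dots,M_k$ be $m\times n$ matrices over $\mathbb{F}_q$, and let $N=\binom{n}{r}$. Let $V_{\text{minors}}\subseteq\mathbb{F}_q^k$ and $V_{\text{supp}}^{\text{Gb}}\subseteq\mathbb{F}_q^k\times\mathbb{F}_q^N$ be the sets defined in the context, and let $\pi:\mathbb{F}_q^k\times\mathbb{F}_q^N\to\mathbb{F}_q^k$ be the projection onto the first factor. Then $\pi(V^{\text{Gb}}_{\text{supp}})=V_{\text{minors}}$.
   Context: Notation: $[n]=\{1,\dots,n\}$; $\mathcal{P}_r(n)$ is the collection of all $r$-element subsets of $[n]$; $\text{sgn}(j,S)=\#\{i\in S:i<j\}$. Coordinates of $\mathbb{F}_q^N$ are indexed by $\mathcal{P}_r(n)$, so $\boldsymbol{c}=(c_T)_{T\in\mathcal{P}_r(n)}$; $\boldsymbol{0}_N$ is the zero vector. For $\boldsymbol{a}=(a_1,\dots,a_k)\in\mathbb{F}_q^k$, $\boldsymbol{M_a}=\sum_{i=1}^k a_iM_i$, with $(i,j)$-th entry $u_{i,j}(\boldsymbol{a})$. - $V_{\text{minors}}$ is the set of all $\boldsymbol{a}\in\mathbb{F}_q^k$ such that all $(r+1)$-minors of $\boldsymbol{M_a}$ vanish (equivalently $\text{rank}\,\boldsymbol{M_a}\le r$). - $V_{\text{supp}}^{\text{Gb}}$ is the set of all $(\boldsymbol{a},\boldsymbol{c})\in\mathbb{F}_q^k\times\mathbb{F}_q^N$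 with $\boldsymbol{c}\neq\boldsymbol{0}_N$ such that $\sum_{j\in S}(-1)^{\text{sgn}(j,S)}u_{i,j}(\boldsymbol{a})\,c_{S\setminus\{j\}}=0$ for all $i\in[m]$ and all $S\in\mathcal{P}_{r+1}(n)$. *)

theory Defs
  imports "Jordan_Normal_Form.DL_Submatrix" "Jordan_Normal_Form.Determinant"
    "HOL-Library.FuncSet"
begin

text \<open>
  Rows, columns, and the matrices themselves are numbered from 0, as in the matrix library, so
  the set $[n]$ is rendered as \<^term>\<open>{..<n}\<close>. The shift by one preserves the order of the
  indices and hence the signs below and the order of the rows and columns in a minor.
\<close>

definition subsets_of_size :: "nat \<Rightarrow> nat \<Rightarrow> nat set set" where
  "subsets_of_size r n = {T. T \<subseteq> {..<n} \<and> card T = r}"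

lemma card_subsets_of_size: "card (subsets_of_size r n) = n choose r"
  using n_subsets[of "{..<n}" r] by (simp add: subsets_of_size_def)

definition sgn_count :: "nat \<Rightarrow> nat set \<Rightarrow> nat" where
  "sgn_count j S = card {i \<in> S. i < j}"

definition lin_comb_mat ::
  "nat \<Rightarrow> nat \<Rightarrow> nat \<Rightarrow> (nat \<Rightarrow> 'a::field mat) \<Rightarrow> 'a vec \<Rightarrow> 'a mat" where
  "lin_comb_mat k m n M a = mat m n (\<lambda>(i, j). \<Sum>l<k. a $ l * M l $$ (i, j))"

text \<open>
  The space $F^N$ with $N = {n \choose r}$ and coordinates indexed by the \<open>r\<close>-subsets.
  Extensionality makes each function represent exactly one coordinate vector.
\<close>

definition coord_space :: "nat \<Rightarrow> nat \<Rightarrow> (nat set \<Rightarrow> 'a::field) set" where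
  "coord_space r n = (subsets_of_size r n \<rightarrow>\<^sub>E UNIV)"

definition zero_coord :: "nat \<Rightarrow> nat \<Rightarrow> nat set \<Rightarrow> 'a::field" where
  "zero_coord r n = (\<lambda>T\<in>subsets_of_size r n. 0)"

definition V_minors ::
  "nat \<Rightarrow> nat \<Rightarrow> nat \<Rightarrow> nat \<Rightarrow> (nat \<Rightarrow> 'a::field mat) \<Rightarrow> 'a vec set" where
  "V_minors k m n r M =
    {a \<in> carrier_vec k.
      \<forall>I \<in> subsets_of_size (r + 1) m. \<forall>J \<in> subsets_of_size (r + 1) n.
        det (submatrix (lin_comb_mat k m n M a) I J) = 0}"

definition V_supp_Gb ::
  "nat \<Rightarrow> nat \<Rightarrow> nat \<Rightarrow> nat \<Rightarrow> (nat \<Rightarrow> 'a::field mat) \<Rightarrow> ('a vec \<times> (nat set \<Rightarrow> 'a)) set" where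
  "V_supp_Gb k m n r M =
    {(a, c). a \<in> carrier_vec k \<and> c \<in> coord_space r n \<and> c \<noteq> zero_coord r n \<and>
      (\<forall>i<m. \<forall>S \<in> subsets_of_size (r + 1) n.
        (\<Sum>j\<in>S. (-1) ^ sgn_count j S * lin_comb_mat k m n M a $$ (i, j) * c (S - {j})) = 0)}"

end

theory Submission
  imports Defs
begin

text \<open>
  For a fixed $a$, put $A = M_a$ and read a coordinate vector $c$ as an element of the $r$-th
  exterior power of $F^n$. The equations defining the support variety say that $v \wedge c = 0$
  for each row $v$ of $A$, so the theorem says that some nonzero $c$ is killed by all rows exactly
  if $A$ has rank at most $r$. Fibre by fibre this is \<open>exists_annihilated_iff_minors_vanish\<close>.

  If some minor of size $r + 1$ with column set $J$ is nonzero, row operations produce, for each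
  $j \in J$, a combination $v_j$ of the rows that restricts to the unit vector $e_j$ on $J$. For
  $|T| = r$ choose $j \in J \setminus T$ and read $v_j \wedge c = 0$ at the coordinate
  $T \cup \{j\}$: it expresses $c_T$ through values $c_{T'}$ where $T'$ has fewer elements outside
  $J$ than $T$ has. By induction $c = 0$ (\<open>wedge_indep_rows_eq_0_imp_0\<close>).

  If all these minors vanish, then $r$ of the columns span all the others
  (\<open>spanning_columns\<close>). The coefficients of the columns over the spanning ones form the $r$ rows of
  a matrix $b$ whose row space contains every row of $A$. The wedge product $c$ of the rows of $b$,
  whose coordinates are the maximal minors of $b$, is then killed by each row of $A$: Laplace
  expansion turns the coordinates of $v \wedge c$ into determinants with linearly dependent rows.
  It is nonzero because $b$ is the identity on the spanning columns
  (\<open>exists_annihilated_by_rows\<close>).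

  Both halves see the minors of $A$ only through the existence of dual rows, that is, of the family
  $v_j$. Dual rows are indexed by sets, so rows and columns can be added without following their
  order and the resulting signs; \<open>det_submatrix_nonzero_iff_indep_cols\<close> is the translation.
\<close>

section \<open>Linear combinations of rows and independent columns\<close>

definition row_comb :: "(nat \<Rightarrow> nat \<Rightarrow> 'a::field) \<Rightarrow> nat set \<Rightarrow> (nat \<Rightarrow> 'a) \<Rightarrow> bool" where
  "row_comb A I v \<longleftrightarrow> (\<exists>x. \<forall>l. v l = (\<Sum>i\<in>I. x i * A i l))"

text \<open>
  Independence of the columns in $J$, with entries taken from the rows in $I$ only, in dual form:
  each coordinate on $J$ is picked out by a combination of rows. The combinations $v$ are vectors
  over all columns, although only their entries in $J$ are prescribed; the other entries become
  the coefficients of the remaining columns over those in $J$ once $J$ is maximal.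
\<close>

definition indep_cols :: "(nat \<Rightarrow> nat \<Rightarrow> 'a::field) \<Rightarrow> nat set \<Rightarrow> nat set \<Rightarrow> bool" where
  "indep_cols A I J \<longleftrightarrow>
    (\<forall>j\<in>J. \<exists>v. row_comb A I v \<and> (\<forall>l\<in>J. v l = (if l = j then 1 else 0)))"

lemma row_combI:
  assumes "\<And>l. v l = (\<Sum>i\<in>I. x i * A i l)"
  shows "row_comb A I v"
  using assms unfolding row_comb_def by blast

lemma row_comb_mono:
  assumes "row_comb A I v" "I \<subseteq> I'" "finite I'"
  shows "row_comb A I' v"
proof -
  obtain x where x: "\<And>l. v l = (\<Sum>i\<in>I. x i * A i l)"
    using assms(1) unfolding row_comb_def by blast
  have "v l = (\<Sum>i\<in>I'. (if i \<in> I then x i else 0) * A i l)" for l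
    unfolding x using assms(2,3) by (intro sum.mono_neutral_cong_left) auto
  then show ?thesis by (rule row_combI)
qed

lemma row_comb_row:
  assumes "i \<in> I" "finite I"
  shows "row_comb A I (A i)"
proof (rule row_combI)
  have "(\<Sum>i'\<in>I. (if i' = i then 1 else 0) * A i' l) = (\<Sum>i'\<in>I. if i' = i then A i l else 0)" for l
    by (intro sum.cong) auto
  then show "A i l = (\<Sum>i'\<in>I. (if i' = i then 1 else 0) * A i' l)" for l
    using assms by simp
qed

lemma row_comb_scale:
  assumes "row_comb A I v"
  shows "row_comb A I (\<lambda>l. c * v l)"
proof -
  obtain x where x: "\<And>l. v l = (\<Sum>i\<in>I. x i * A i l)"
    using assms unfolding row_comb_def by blast
  have "c * v l = (\<Sum>i\<in>I. (c * x i) * A i l)" for l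
    unfolding x by (simp add: sum_distrib_left mult.assoc)
  then show ?thesis by (rule row_combI)
qed

lemma row_comb_diff:
  assumes "row_comb A I v" "row_comb A I w"
  shows "row_comb A I (\<lambda>l. v l - w l)"
proof -
  obtain x y where "\<And>l. v l = (\<Sum>i\<in>I. x i * A i l)" "\<And>l. w l = (\<Sum>i\<in>I. y i * A i l)"
    using assms unfolding row_comb_def by blast
  then have "v l - w l = (\<Sum>i\<in>I. (x i - y i) * A i l)" for l
    by (simp add: sum_subtractf left_diff_distrib)
  then show ?thesis by (rule row_combI)
qed

lemma row_comb_sum:
  assumes "finite J" "\<And>j. j \<in> J \<Longrightarrow> row_comb A I (v j)"
  shows "row_comb A I (\<lambda>l. \<Sum>j\<in>J. v j l)"
proof -
  have "\<forall>j\<in>J. \<exists>x. \<forall>l. v j l = (\<Sum>i\<in>I. x i * A i l)"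
    using assms(2) unfolding row_comb_def by blast
  then obtain x where "\<forall>j\<in>J. \<forall>l. v j l = (\<Sum>i\<in>I. x j i * A i l)" by metis
  then have "(\<Sum>j\<in>J. v j l) = (\<Sum>i\<in>I. (\<Sum>j\<in>J. x j i) * A i l)" for l
    by (simp add: sum_distrib_right sum.swap[of _ I J])
  then show ?thesis by (rule row_combI)
qed

lemma indep_cols_dual_rows:
  assumes "indep_cols A I J"
  obtains v where "\<And>j. j \<in> J \<Longrightarrow> row_comb A I (v j)"
    and "\<And>j l. j \<in> J \<Longrightarrow> l \<in> J \<Longrightarrow> v j l = (if l = j then 1 else 0)"
  using assms unfolding indep_cols_def by metis

lemma indep_cols_mono:
  assumes "indep_cols A I J" "I \<subseteq> I'" "finite I'"
  shows "indep_cols A I' J"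
  using assms row_comb_mono unfolding indep_cols_def by meson

text \<open>
  The bordering step of Gaussian elimination. The row $i_0$ minus the combination of the dual rows
  that agrees with it on $J$ vanishes on $J$ but not at $l_0$; scaled, it becomes the dual row of
  $l_0$, and subtracting multiples of it clears the entries at $l_0$ of the old dual rows. The row
  $i_0$ may already belong to $I$, in which case $I$ does not grow.
\<close>

lemma indep_cols_insert:
  assumes fin: "finite I" "finite J"
    and v: "\<And>j. j \<in> J \<Longrightarrow> row_comb A I (v j)"
    and dual: "\<And>j l. j \<in> J \<Longrightarrow> l \<in> J \<Longrightarrow> v j l = (if l = j then 1 else 0)"
    and ne: "A i\<^sub>0 l\<^sub>0 \<noteq> (\<Sum>j\<in>J. A i\<^sub>0 j * v j l\<^sub>0)"
  shows "l\<^sub>0 \<notin> J" and "indep_cols A (insert i\<^sub>0 I) (insert l\<^sub>0 J)"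
proof -
  define u where "u l = A i\<^sub>0 l - (\<Sum>j\<in>J. A i\<^sub>0 j * v j l)" for l
  have u0: "u l\<^sub>0 \<noteq> 0" using ne by (simp add: u_def)
  have uJ: "u l = 0" if "l \<in> J" for l
  proof -
    have "(\<Sum>j\<in>J. A i\<^sub>0 j * v j l) = (\<Sum>j\<in>J. if j = l then A i\<^sub>0 l else 0)"
      using that dual by (intro sum.cong) auto
    then show ?thesis using that fin by (simp add: u_def)
  qed
  show l0: "l\<^sub>0 \<notin> J" using u0 uJ by blast
  let ?I = "insert i\<^sub>0 I"
  have v': "row_comb A ?I (v j)" if "j \<in> J" for j
    using row_comb_mono[OF v[OF that]] fin by auto
  have u: "row_comb A ?I u"
    unfolding u_def using fin v'
    by (intro row_comb_diff row_comb_row row_comb_sum row_comb_scale) auto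
  define e where "e l = inverse (u l\<^sub>0) * u l" for l
  have e: "row_comb A ?I e" unfolding e_def using u by (rule row_comb_scale)
  have eval: "e l\<^sub>0 = 1" "\<And>l. l \<in> J \<Longrightarrow> e l = 0" using u0 uJ by (auto simp: e_def)
  show "indep_cols A ?I (insert l\<^sub>0 J)"
    unfolding indep_cols_def
  proof
    fix j assume j: "j \<in> insert l\<^sub>0 J"
    show "\<exists>w. row_comb A ?I w \<and> (\<forall>l\<in>insert l\<^sub>0 J. w l = (if l = j then 1 else 0))"
    proof (cases "j = l\<^sub>0")
      case True
      then show ?thesis using e eval l0 by (intro exI[of _ e]) auto
    next
      case False
      then have jJ: "j \<in> J" using j by blast
      have "row_comb A ?I (\<lambda>l. v j l - v j l\<^sub>0 * e l)"
        using v'[OF jJ] e by (intro row_comb_diff row_comb_scale)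
      then show ?thesis using eval dual jJ l0 False
        by (intro exI[of _ "\<lambda>l. v j l - v j l\<^sub>0 * e l"]) auto
    qed
  qed
qed

text \<open>
  Take $J$ as large as possible among the column sets of size at most $r$ that are independent on
  at most $|J|$ rows. By maximality, or by the last hypothesis if $|J| = r$ already, $J$
  cannot be extended, so the columns in $J$ span all columns with the entries of the dual rows as
  coefficients. If $|J| < r$, then $J$ is filled up with arbitrary columns.
\<close>

lemma spanning_columns:
  assumes rm: "r < m" and rn: "r \<le> n"
    and none: "\<And>I J. I \<in> subsets_of_size (r + 1) m \<Longrightarrow> J \<in> subsets_of_size (r + 1) n
      \<Longrightarrow> \<not> indep_cols A I J"
  obtains K b where "K \<in> subsets_of_size r n"
    and "\<And>j l. j \<in> K \<Longrightarrow> l \<in> K \<Longrightarrow> b j l = (if l = j then 1 else 0)"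
    and "\<And>i l. i < m \<Longrightarrow> l < n \<Longrightarrow> A i l = (\<Sum>j\<in>K. A i j * b j l)"
proof -
  \<comment> \<open>Asking only for at most as many rows as columns makes it irrelevant whether the row that is
    added by the bordering step is new; missing rows are supplied at the end.\<close>
  define P where "P s \<longleftrightarrow> s \<le> r \<and> (\<exists>I J. I \<subseteq> {..<m} \<and> J \<subseteq> {..<n} \<and> card I \<le> card J \<and>
    card J = s \<and> indep_cols A I J)" for s
  have "P 0" unfolding P_def by (auto simp: indep_cols_def intro!: exI[of _ "{}"])
  then obtain s where Ps: "P s" and max: "\<And>t. P t \<Longrightarrow> t \<le> s"
    using Nat.ex_has_greatest_nat[of P 0 r] P_def by blast
  obtain I J where IJ: "I \<subseteq> {..<m}" "J \<subseteq> {..<n}" "card I \<le> card J" "card J = s"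
    and ind: "indep_cols A I J" and sr: "s \<le> r"
    using Ps unfolding P_def by blast
  have fin: "finite I" "finite J" using IJ(1,2) finite_subset by auto
  obtain v where v: "\<And>j. j \<in> J \<Longrightarrow> row_comb A I (v j)"
    and dual: "\<And>j l. j \<in> J \<Longrightarrow> l \<in> J \<Longrightarrow> v j l = (if l = j then 1 else 0)"
    using indep_cols_dual_rows[OF ind] by blast
  have span: "A i l = (\<Sum>j\<in>J. A i j * v j l)" if il: "i < m" "l < n" for i l
  proof (rule ccontr)
    assume ne: "A i l \<noteq> (\<Sum>j\<in>J. A i j * v j l)"
    note ext = indep_cols_insert[OF fin v dual ne]
    have sub: "insert i I \<subseteq> {..<m}" "insert l J \<subseteq> {..<n}" using IJ il by auto
    have cJ: "card (insert l J) = s + 1" using ext(1) fin IJ by simp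
    have cI: "card (insert i I) \<le> s + 1"
      using IJ card_insert_le_m1[of "s + 1" I i] by simp
    show False
    proof (cases "s = r")
      case True
      obtain I' where I': "insert i I \<subseteq> I'" "I' \<subseteq> {..<m}" "card I' = r + 1"
        using exists_subset_between[of "insert i I" "r + 1" "{..<m}"] cI True sub rm by auto
      have "indep_cols A I' (insert l J)"
        using indep_cols_mono[OF ext(2) I'(1)] I'(2) finite_subset by blast
      then show False
        using none[of I' "insert l J"] I' sub cJ True by (auto simp: subsets_of_size_def)
    next
      case False
      then have "P (s + 1)" unfolding P_def using sr sub cI cJ ext(2)
        by (intro conjI exI[of _ "insert i I"] exI[of _ "insert l J"]) auto
      then show False using max by fastforce
    qed
  qed
  obtain K where K: "J \<subseteq> K" "K \<subseteq> {..<n}" "card K = r"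
    using exists_subset_between[of J r "{..<n}"] IJ sr rn by auto
  have finK: "finite K" using K(2) finite_subset by blast
  \<comment> \<open>A column in $K$ must have itself as its expansion, even where the dual row of $J$ is nonzero
    at a column of $K \setminus J$; the other columns are expanded over $J$ alone.\<close>
  define b where "b j l = (if l \<in> K then (if l = j then 1 else 0)
    else if j \<in> J then v j l else 0)" for j l
  show thesis
  proof (rule that[of K b])
    show "K \<in> subsets_of_size r n" using K by (simp add: subsets_of_size_def)
    show "b j l = (if l = j then 1 else 0)" if "l \<in> K" for j l
      using that by (simp add: b_def)
    show "A i l = (\<Sum>j\<in>K. A i j * b j l)" if il: "i < m" "l < n" for i l
    proof (cases "l \<in> K")
      case True
      have "(\<Sum>j\<in>K. A i j * b j l) = (\<Sum>j\<in>K. if j = l then A i l else 0)"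
        using True by (intro sum.cong) (auto simp: b_def)
      then show ?thesis using finK True by simp
    next
      case False
      have "(\<Sum>j\<in>K. A i j * b j l) = (\<Sum>j\<in>J. A i j * v j l)"
        using False K finK by (intro sum.mono_neutral_cong_right) (auto simp: b_def)
      then show ?thesis using span[OF il] by simp
    qed
  qed
qed

section \<open>Independent columns and nonzero minors\<close>

lemma bij_betw_pick:
  assumes "finite S"
  shows "bij_betw (pick S) {..<card S} S"
proof -
  have "inj_on (pick S) {..<card S}"
    by (intro inj_onI) (metis card_pick_le lessThan_iff)
  moreover have "pick S ` {..<card S} \<subseteq> S" using pick_in_set_le by auto
  ultimately show ?thesis using assms
    by (metis bij_betw_def card_image card_lessThan card_subset_eq)
qed

text \<open>The coefficients of the dual rows are the entries of a left inverse of the submatrix.\<close>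

lemma det_submatrix_nonzero_iff_indep_cols:
  fixes A :: "'a::field mat"
  assumes A: "A \<in> carrier_mat m n"
    and I: "I \<in> subsets_of_size s m" and J: "J \<in> subsets_of_size s n"
  shows "det (submatrix A I J) \<noteq> 0 \<longleftrightarrow> indep_cols (\<lambda>i l. A $$ (i, l)) I J"
proof -
  let ?B = "submatrix A I J"
  have sub: "I \<subseteq> {..<m}" "card I = s" "J \<subseteq> {..<n}" "card J = s"
    using I J by (auto simp: subsets_of_size_def)
  then have fin: "finite I" "finite J" using finite_subset by auto
  have sets: "{i. i < dim_row A \<and> i \<in> I} = I" "{j. j < dim_col A \<and> j \<in> J} = J"
    using sub A by auto
  have B: "?B \<in> carrier_mat s s"
    and Bij: "\<And>p q. p < s \<Longrightarrow> q < s \<Longrightarrow> ?B $$ (p, q) = A $$ (pick I p, pick J q)"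
    unfolding submatrix_def sets using sub by auto
  have bI: "bij_betw (pick I) {..<s} I" and bJ: "bij_betw (pick J) {..<s} J"
    using bij_betw_pick fin sub by metis+
  have pickJ: "pick J q \<in> J" "(pick J q = pick J q') = (q = q')" if "q < s" "q' < s" for q q'
    using bJ that by (auto simp: bij_betw_def inj_on_def)
  show ?thesis
  proof
    assume "det ?B \<noteq> 0"
    then obtain C where C: "C \<in> carrier_mat s s" "C * ?B = 1\<^sub>m s"
      using det_non_zero_imp_unit[OF B, of "()"] by (auto simp: Units_def ring_mat_def)
    show "indep_cols (\<lambda>i l. A $$ (i, l)) I J"
      unfolding indep_cols_def
    proof
      fix j assume "j \<in> J"
      then obtain q where q: "q < s" "j = pick J q" using bJ unfolding bij_betw_def by blast
      define x where "x i = C $$ (q, the_inv_into {..<s} (pick I) i)" for i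
      have x: "x (pick I p) = C $$ (q, p)" if "p < s" for p
        using that the_inv_into_f_f[OF bij_betw_imp_inj_on[OF bI], of p] by (simp add: x_def)
      have "(\<Sum>i\<in>I. x i * A $$ (i, l)) = (if l = j then 1 else 0)" if l: "l \<in> J" for l
      proof -
        obtain q' where q': "q' < s" "l = pick J q'"
          using l bJ unfolding bij_betw_def by blast
        have "(\<Sum>i\<in>I. x i * A $$ (i, l)) = (\<Sum>p<s. x (pick I p) * A $$ (pick I p, l))"
          by (rule sum.reindex_bij_betw[OF bI, symmetric])
        also have "\<dots> = (\<Sum>p<s. C $$ (q, p) * ?B $$ (p, q'))"
          using x Bij q' by (intro sum.cong) auto
        also have "\<dots> = (C * ?B) $$ (q, q')"
          using C(1) B q q' by (simp add: scalar_prod_def lessThan_atLeast0)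
        finally show ?thesis using C(2) q q' pickJ by auto
      qed
      moreover have "row_comb (\<lambda>i l. A $$ (i, l)) I (\<lambda>l. \<Sum>i\<in>I. x i * A $$ (i, l))"
        by (rule row_combI) simp
      ultimately show "\<exists>v. row_comb (\<lambda>i l. A $$ (i, l)) I v \<and>
          (\<forall>l\<in>J. v l = (if l = j then 1 else 0))" by blast
    qed
  next
    assume "indep_cols (\<lambda>i l. A $$ (i, l)) I J"
    then have "\<exists>x. \<forall>l\<in>J. (\<Sum>i\<in>I. x i * A $$ (i, l)) = (if l = j then 1 else 0)"
      if "j \<in> J" for j
      using that unfolding indep_cols_def row_comb_def by fastforce
    then obtain x where x: "\<And>j l. j \<in> J \<Longrightarrow> l \<in> J \<Longrightarrow>
        (\<Sum>i\<in>I. x j i * A $$ (i, l)) = (if l = j then 1 else 0)"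
      by metis
    define C where "C = mat s s (\<lambda>(q, p). x (pick J q) (pick I p))"
    have C: "C \<in> carrier_mat s s" by (simp add: C_def)
    have "C * ?B = 1\<^sub>m s"
    proof (rule eq_matI)
      fix q q' assume "q < dim_row (1\<^sub>m s)" "q' < dim_col (1\<^sub>m s)"
      then have q: "q < s" "q' < s" by auto
      have "(C * ?B) $$ (q, q') = (\<Sum>p<s. C $$ (q, p) * ?B $$ (p, q'))"
        using C B q by (simp add: scalar_prod_def lessThan_atLeast0)
      also have "\<dots> = (\<Sum>p<s. x (pick J q) (pick I p) * A $$ (pick I p, pick J q'))"
        using Bij q by (intro sum.cong) (auto simp: C_def)
      also have "\<dots> = (\<Sum>i\<in>I. x (pick J q) i * A $$ (i, pick J q'))"
        by (rule sum.reindex_bij_betw[OF bI])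
      finally show "(C * ?B) $$ (q, q') = 1\<^sub>m s $$ (q, q')"
        using x pickJ q by auto
    qed (use B C in auto)
    then have "det C * det ?B = 1" using det_mult[OF C B] by simp
    then show "det ?B \<noteq> 0" by auto
  qed
qed

section \<open>Exterior multiplication by a vector, in coordinates\<close>

text \<open>
  The coordinates of $v \wedge c$ for a vector $v$ and an alternating tensor $c$: the left-hand
  sides of the equations of the support variety, with $v$ a row of $M_a$.
\<close>

definition wedge :: "(nat \<Rightarrow> 'a::field) \<Rightarrow> (nat set \<Rightarrow> 'a) \<Rightarrow> nat set \<Rightarrow> 'a" where
  "wedge v c S = (\<Sum>j\<in>S. (-1) ^ sgn_count j S * v j * c (S - {j}))"

lemma wedge_row_comb_eq_0:
  assumes "row_comb A I v" and "\<And>i. i \<in> I \<Longrightarrow> wedge (A i) c S = 0"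
  shows "wedge v c S = 0"
proof -
  obtain x where x: "\<And>l. v l = (\<Sum>i\<in>I. x i * A i l)"
    using assms(1) unfolding row_comb_def by blast
  have "wedge v c S = (\<Sum>j\<in>S. \<Sum>i\<in>I. x i * ((-1) ^ sgn_count j S * A i j * c (S - {j})))"
    unfolding wedge_def x by (simp add: sum_distrib_left sum_distrib_right ac_simps)
  also have "\<dots> = (\<Sum>i\<in>I. x i * wedge (A i) c S)"
    unfolding wedge_def by (subst sum.swap) (simp add: sum_distrib_left)
  finally show ?thesis using assms(2) by simp
qed

text \<open>
  An element of the $r$-th exterior power that is killed by $r + 1$ independent vectors is divisible
  by their product, which has degree $r + 1$, so it is zero. In coordinates this becomes an
  induction on $|T \setminus J|$.
\<close>

lemma wedge_indep_rows_eq_0_imp_0: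
  assumes ind: "indep_cols A I J" and J: "J \<in> subsets_of_size (r + 1) n"
    and w: "\<And>i S. i \<in> I \<Longrightarrow> S \<in> subsets_of_size (r + 1) n \<Longrightarrow> wedge (A i) c S = 0"
    and T: "T \<in> subsets_of_size r n"
  shows "c T = 0"
proof -
  obtain v where v: "\<And>j. j \<in> J \<Longrightarrow> row_comb A I (v j)"
    and dual: "\<And>j l. j \<in> J \<Longrightarrow> l \<in> J \<Longrightarrow> v j l = (if l = j then 1 else 0)"
    using indep_cols_dual_rows[OF ind] by blast
  show ?thesis using T
  proof (induction "card (T - J)" arbitrary: T rule: less_induct)
    case less
    have T: "T \<subseteq> {..<n}" "card T = r" "finite T"
      using less.prems by (auto simp: subsets_of_size_def finite_subset)
    have "\<not> J \<subseteq> T" using J T card_mono[of T J] by (auto simp: subsets_of_size_def)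
    then obtain j where j: "j \<in> J" "j \<notin> T" by blast
    let ?S = "insert j T"
    have S: "?S \<in> subsets_of_size (r + 1) n"
      using T j J by (auto simp: subsets_of_size_def)
    \<comment> \<open>In the equation at $T \cup \{j\}$ the columns of $T \cap J$ do not occur, since the dual row
      vanishes there, and those of $T \setminus J$ lead to sets covered by the induction
      hypothesis.\<close>
    have van: "(-1) ^ sgn_count l ?S * v j l * c (?S - {l}) = 0" if l: "l \<in> T" for l
    proof (cases "l \<in> J")
      case True
      then show ?thesis using dual[OF j(1) True] l j by auto
    next
      case False
      have "?S - {l} \<in> subsets_of_size r n"
        using T j J l by (auto simp: subsets_of_size_def)
      moreover have "?S - {l} - J \<subset> T - J" using j l False by auto
      then have "card (?S - {l} - J) < card (T - J)" using T by (intro psubset_card_mono) auto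
      ultimately show ?thesis using less.hyps[of "?S - {l}"] by simp
    qed
    have "0 = wedge (v j) c ?S"
      using wedge_row_comb_eq_0[OF v[OF j(1)]] w S by metis
    also have "\<dots> = (-1) ^ sgn_count j ?S * v j j * c (?S - {j})
        + (\<Sum>l\<in>T. (-1) ^ sgn_count l ?S * v j l * c (?S - {l}))"
      unfolding wedge_def using T j by (simp add: sum.insert)
    also have "(\<Sum>l\<in>T. (-1) ^ sgn_count l ?S * v j l * c (?S - {l})) = 0"
      using van by (intro sum.neutral) blast
    finally show ?case using dual[OF j(1) j(1)] j by simp
  qed
qed

section \<open>Maximal minors as an annihilated vector\<close>

text \<open>The coordinates of the decomposable tensor $w_0 \wedge \dots \wedge w_{r-1}$.\<close>

definition row_minor :: "nat \<Rightarrow> (nat \<Rightarrow> nat \<Rightarrow> 'a::field) \<Rightarrow> nat set \<Rightarrow> 'a" where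
  "row_minor r w T = det (mat r r (\<lambda>(p, q). w p (pick T q)))"

lemma pick_delete:
  assumes "finite S" "j < card S" "q < card S - 1"
  shows "pick (S - {pick S j}) q = pick S (if q < j then q else Suc q)"
proof -
  define q' where "q' = (if q < j then q else Suc q)"
  have q': "q' < card S" "q' \<noteq> j" using assms by (auto simp: q'_def)
  have mem: "pick S q' \<in> S - {pick S j}"
    using q' assms bij_betw_pick[of S] by (auto simp: bij_betw_def inj_on_def)
  have lt: "pick S j < pick S q' \<longleftrightarrow> j < q'"
    using q' assms pick_mono_le by (metis linorder_neqE_nat order_less_asym)
  have "{a \<in> S - {pick S j}. a < pick S q'} = {a \<in> S. a < pick S q'} - {pick S j}" by auto
  moreover have "pick S j \<in> {a \<in> S. a < pick S q'} \<longleftrightarrow> j < q'"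
    using lt pick_in_set_le assms by auto
  ultimately have "card {a \<in> S - {pick S j}. a < pick S q'} = (if j < q' then q' - 1 else q')"
    using card_pick_le[OF q'(1)] assms(1) by (simp add: card_Diff_singleton_if)
  also have "\<dots> = q" by (auto simp: q'_def)
  finally show ?thesis using pick_card_in_set[OF mem] by (simp add: q'_def)
qed

text \<open>
  Wedging once more with $v$ adds $v$ as the top row of the determinant: the wedge sum is the
  Laplace expansion along this row, because the number of elements of $S$ below $j$ is the
  position of the column $j$.
\<close>

lemma wedge_row_minor:
  assumes S: "finite S" "card S = Suc r"
  shows "wedge v (row_minor r w) S = row_minor (Suc r) (case_nat v w) S"
proof -
  let ?C = "mat (Suc r) (Suc r) (\<lambda>(p, q). case_nat v w p (pick S q))"
  have del: "det (mat_delete ?C 0 j) = row_minor r w (S - {pick S j})" if j: "j < Suc r" for j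
    unfolding row_minor_def using S j
    by (intro arg_cong[of _ _ det] eq_matI) (auto simp: mat_delete_def pick_delete)
  have sg: "sgn_count (pick S j) S = j" if "j < Suc r" for j
    using that S by (simp add: sgn_count_def card_pick_le)
  have "row_minor (Suc r) (case_nat v w) S = (\<Sum>j<Suc r. ?C $$ (0, j) * cofactor ?C 0 j)"
    unfolding row_minor_def by (rule laplace_expansion_row) auto
  also have "\<dots> = (\<Sum>j<Suc r. (-1) ^ sgn_count (pick S j) S * v (pick S j)
      * row_minor r w (S - {pick S j}))"
    by (intro sum.cong) (auto simp: cofactor_def del sg)
  also have "\<dots> = wedge v (row_minor r w) S"
    unfolding wedge_def using bij_betw_pick[OF S(1)] unfolding S(2)
    by (rule sum.reindex_bij_betw)
  finally show ?thesis by simp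
qed

lemma wedge_row_minor_eq_0:
  assumes S: "finite S" "card S = Suc r"
    and dep: "\<And>l. l \<in> S \<Longrightarrow> v l = (\<Sum>p<r. x p * w p l)"
  shows "wedge v (row_minor r w) S = 0"
proof -
  let ?C = "mat (Suc r) (Suc r) (\<lambda>(p, q). case_nat v w p (pick S q))"
  \<comment> \<open>The coefficients of a linear relation among the rows of \<open>?C\<close>.\<close>
  define y where "y = vec (Suc r) (case_nat (-1) x)"
  have "?C\<^sup>T *\<^sub>v y = 0\<^sub>v (Suc r)"
  proof (rule eq_vecI)
    fix q assume "q < dim_vec (0\<^sub>v (Suc r) :: 'a vec)"
    then have q: "q < Suc r" by simp
    have mem: "pick S q \<in> S" using pick_in_set_le[of q S] q S by simp
    have "(?C\<^sup>T *\<^sub>v y) $ q = (\<Sum>p<Suc r. case_nat v w p (pick S q) * case_nat (-1) x p)"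
      using q by (simp add: scalar_prod_def y_def lessThan_atLeast0 del: sum.lessThan_Suc)
    also have "\<dots> = - v (pick S q) + (\<Sum>p<r. w p (pick S q) * x p)"
      by (simp add: sum.lessThan_Suc_shift del: sum.lessThan_Suc)
    also have "\<dots> = 0" using dep[OF mem] by (simp add: mult.commute)
    finally show "(?C\<^sup>T *\<^sub>v y) $ q = 0\<^sub>v (Suc r) $ q" using q by simp
  qed simp
  moreover have "y \<noteq> 0\<^sub>v (Suc r)"
  proof
    assume "y = 0\<^sub>v (Suc r)"
    then have "y $ 0 = 0" by simp
    then show False by (simp add: y_def)
  qed
  moreover have "y \<in> carrier_vec (Suc r)" by (simp add: y_def)
  ultimately have "det (?C\<^sup>T) = 0"
    by (subst det_0_iff_vec_prod_zero[of _ "Suc r"]) auto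
  then have "det ?C = 0" by (subst (asm) det_transpose[of _ "Suc r"]) auto
  then show ?thesis using wedge_row_minor[OF S, of v w] by (simp add: row_minor_def)
qed

text \<open>
  The witness is the tensor of maximal minors of the coefficient matrix $b$ of the spanning
  columns $K$. Each row of $A$ is a combination of the rows of $b$, with its own entries in $K$ as
  coefficients, so it kills the tensor. The coordinate at $K$ is the determinant of the identity
  matrix, so the tensor is nonzero.
\<close>

lemma exists_annihilated_by_rows:
  fixes A :: "nat \<Rightarrow> nat \<Rightarrow> 'a::field"
  assumes "r < m" "r \<le> n"
    and "\<And>I J. I \<in> subsets_of_size (r + 1) m \<Longrightarrow> J \<in> subsets_of_size (r + 1) n
      \<Longrightarrow> \<not> indep_cols A I J"
  obtains K c where "K \<in> subsets_of_size r n" "c K \<noteq> 0"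
    and "\<forall>i<m. \<forall>S\<in>subsets_of_size (r + 1) n. wedge (A i) c S = 0"
proof -
  obtain K b where K: "K \<in> subsets_of_size r n"
    and dual: "\<And>j l. j \<in> K \<Longrightarrow> l \<in> K \<Longrightarrow> b j l = (if l = j then 1 else 0)"
    and span: "\<And>i l. i < m \<Longrightarrow> l < n \<Longrightarrow> A i l = (\<Sum>j\<in>K. A i j * b j l)"
    using spanning_columns[OF assms] by blast
  have cK: "finite K" "card K = r" using K by (auto simp: subsets_of_size_def finite_subset)
  have bK: "bij_betw (pick K) {..<r} K" using bij_betw_pick cK by metis
  let ?w = "\<lambda>p. b (pick K p)"
  show thesis
  proof (rule that[of K "row_minor r ?w"])
    have "?w p (pick K q) = (if p = q then 1 else 0)" if "p < r" "q < r" for p q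
    proof -
      have "pick K p \<in> K" "pick K q \<in> K" "pick K q = pick K p \<longleftrightarrow> p = q"
        using that bK by (auto simp: bij_betw_def inj_on_def)
      then show ?thesis using dual by simp
    qed
    then have "mat r r (\<lambda>(p, q). ?w p (pick K q)) = 1\<^sub>m r"
      by (intro eq_matI) auto
    then show "row_minor r ?w K \<noteq> 0" by (simp add: row_minor_def)
  next
    show "\<forall>i<m. \<forall>S\<in>subsets_of_size (r + 1) n. wedge (A i) (row_minor r ?w) S = 0"
    proof (intro allI impI ballI)
      fix i S assume i: "i < m" and S: "S \<in> subsets_of_size (r + 1) n"
      have S': "finite S" "card S = Suc r" "S \<subseteq> {..<n}"
        using S by (auto simp: subsets_of_size_def finite_subset)
      have "A i l = (\<Sum>p<r. A i (pick K p) * ?w p l)" if "l \<in> S" for l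
        using span[OF i, of l] that S'(3) sum.reindex_bij_betw[OF bK, of "\<lambda>j. A i j * b j l"] by auto
      then show "wedge (A i) (row_minor r ?w) S = 0"
        by (intro wedge_row_minor_eq_0[OF S'(1,2), where x = "\<lambda>p. A i (pick K p)"])
    qed
  qed (rule K)
qed

text \<open>The fibre over a single matrix, with the witness restricted to an extensional function.\<close>

lemma exists_annihilated_iff_minors_vanish:
  fixes A :: "'a::field mat"
  assumes A: "A \<in> carrier_mat m n" and r: "r < m" "r < n"
  shows "(\<exists>c \<in> coord_space r n. c \<noteq> zero_coord r n \<and>
      (\<forall>i<m. \<forall>S \<in> subsets_of_size (r + 1) n. wedge (\<lambda>j. A $$ (i, j)) c S = 0)) \<longleftrightarrow>
    (\<forall>I \<in> subsets_of_size (r + 1) m. \<forall>J \<in> subsets_of_size (r + 1) n.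
      det (submatrix A I J) = 0)"
    (is "?L \<longleftrightarrow> ?R")
proof
  assume ?L
  then obtain c where c: "c \<in> coord_space r n" "c \<noteq> zero_coord r n"
    and w: "\<And>i S. i < m \<Longrightarrow> S \<in> subsets_of_size (r + 1) n \<Longrightarrow> wedge (\<lambda>j. A $$ (i, j)) c S = 0"
    by blast
  show ?R
  proof (intro ballI, rule ccontr)
    fix I J assume I: "I \<in> subsets_of_size (r + 1) m" and J: "J \<in> subsets_of_size (r + 1) n"
      and "det (submatrix A I J) \<noteq> 0"
    then have ind: "indep_cols (\<lambda>i l. A $$ (i, l)) I J"
      using det_submatrix_nonzero_iff_indep_cols[OF A] by blast
    have "c T = 0" if "T \<in> subsets_of_size r n" for T
      by (rule wedge_indep_rows_eq_0_imp_0[OF ind J w that])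
        (use I in \<open>auto simp: subsets_of_size_def\<close>)
    then have "c = zero_coord r n"
      using c(1) by (intro PiE_ext[of c "subsets_of_size r n" "\<lambda>_. UNIV"])
        (auto simp: coord_space_def zero_coord_def)
    then show False using c(2) by blast
  qed
next
  assume ?R
  then have none: "\<not> indep_cols (\<lambda>i l. A $$ (i, l)) I J"
    if "I \<in> subsets_of_size (r + 1) m" "J \<in> subsets_of_size (r + 1) n" for I J
    using det_submatrix_nonzero_iff_indep_cols[OF A that] that by blast
  obtain K c where K: "K \<in> subsets_of_size r n" "c K \<noteq> 0"
    and w: "\<forall>i<m. \<forall>S\<in>subsets_of_size (r + 1) n. wedge (\<lambda>j. A $$ (i, j)) c S = 0"
    by (rule exists_annihilated_by_rows[where A = "\<lambda>i l. A $$ (i, l)",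
          OF r(1) less_imp_le[OF r(2)] none])
  let ?c = "restrict c (subsets_of_size r n)"
  have "wedge v ?c S = wedge v c S" if "S \<in> subsets_of_size (r + 1) n" for v S
    using that unfolding wedge_def by (intro sum.cong) (auto simp: subsets_of_size_def)
  moreover have "?c \<noteq> zero_coord r n"
  proof
    assume "?c = zero_coord r n"
    then have "?c K = zero_coord r n K" by simp
    then show False using K by (simp add: zero_coord_def)
  qed
  moreover have "?c \<in> coord_space r n" by (simp add: coord_space_def)
  ultimately show ?L using w by (intro bexI[of _ ?c]) auto
qed

theorem proposition3p5:
  fixes k m n r :: nat
    and M :: "nat \<Rightarrow> 'a::{field, finite} mat"
  assumes "0 < k" and "0 < m" and "0 < n" and "0 < r"
    and "r < min m n"
    and "\<And>l. l < k \<Longrightarrow> M l \<in> carrier_mat m n"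
  shows "fst ` V_supp_Gb k m n r M = V_minors k m n r M"
proof -
  have "lin_comb_mat k m n M a \<in> carrier_mat m n" for a by (simp add: lin_comb_mat_def)
  note fiber = exists_annihilated_iff_minors_vanish[OF this]
  have "a \<in> fst ` V_supp_Gb k m n r M \<longleftrightarrow> a \<in> V_minors k m n r M" for a
  proof -
    have "a \<in> fst ` V_supp_Gb k m n r M \<longleftrightarrow> (\<exists>c. (a, c) \<in> V_supp_Gb k m n r M)" by force
    then show ?thesis
      using fiber[of r a] assms(5) unfolding V_supp_Gb_def V_minors_def wedge_def by auto
  qed
  then show ?thesis by blast
qed

end
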